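(* There exists an absolute constant $c>0$ such that for all sufficiently large $N$ and all integers $k$ with $1\le k\le N$: every (possibly randomized) protocol in the line model below for which player $P_{k+1}$ outputs $\mathbf{A}_k\mathbf{A}_{k-1}\cdots\mathbf{A}_1\mathbf{x}$ (over $\mathbb{F}_2$) correctly with probability at least $1/2$, when $\mathbf{x}\in\mathbb{F}_2^N$ and $\mathbf{A}_1,\dots,\mathbf{A}_k\in\mathbb{F}_2^{N\times N}$ are uniformly distributed and mutually independent, uses at least $ckN$ rounds.
   Context: Line model: there are $k+2$ players $P_0,\dots,P_{k+1}$ with communication links exactly $\{P_{i-1},P_i\}$ for $i\in[k+1]$. $P_0$ holds $\mathbf{x}$, $P_i$ holds $\mathbf{A}_i$ for $i\in[k]$, and $P_{k+1}$ has no input and must output the answer. Communication is synchronous in rounds; in each round one bit is sent over each link (direction determined by the protocol from previous communication), and each bit a player sends depends only on its input, its randomness and the bits it has received in earlier rounds. *)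

theory Defs
  imports "HOL-Library.Z2" "HOL-Library.FuncSet" "HOL-Probability.Product_PMF"
begin

definition vecs :: "nat \<Rightarrow> (nat \<Rightarrow> bit) set" where
  "vecs N = {0..<N} \<rightarrow>\<^sub>E (UNIV :: bit set)"

definition mats :: "nat \<Rightarrow> (nat \<Rightarrow> nat \<Rightarrow> bit) set" where
  "mats N = {0..<N} \<rightarrow>\<^sub>E vecs N"

definition mvmul :: "nat \<Rightarrow> (nat \<Rightarrow> nat \<Rightarrow> bit) \<Rightarrow> (nat \<Rightarrow> bit) \<Rightarrow> (nat \<Rightarrow> bit)" where
  "mvmul N M v = (\<lambda>r. \<Sum>j<N. M r j * v j)"

fun chain :: "nat \<Rightarrow> (nat \<Rightarrow> nat \<Rightarrow> nat \<Rightarrow> bit) \<Rightarrow> nat \<Rightarrow> (nat \<Rightarrow> bit) \<Rightarrow> (nat \<Rightarrow> bit)" where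
  "chain N A 0 x = x"
| "chain N A (Suc i) x = mvmul N (A (Suc i)) (chain N A i x)"

datatype pinput = VecIn "nat \<Rightarrow> bit" | MatIn "nat \<Rightarrow> nat \<Rightarrow> bit" | NoIn

definition player_input :: "nat \<Rightarrow> (nat \<Rightarrow> bit) \<Rightarrow> (nat \<Rightarrow> nat \<Rightarrow> nat \<Rightarrow> bit) \<Rightarrow> nat \<Rightarrow> pinput" where
  "player_input k x A j = (if j = 0 then VecIn x else if j \<le> k then MatIn (A j) else NoIn)"

(* A (randomized, private-coin) protocol in the line model.
   Link i (1 <= i <= k+1) connects P_(i-1) and P_i.
   - dir i h : direction of link i in the next round, as a function of the
     communication h seen so far on that link (known to both endpoints);
     True = P_(i-1) sends to P_i, False = P_i sends to P_(i-1).
   - msg j inp s l hl hr : the bit player j sends on link l (l = j or l = j+1),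
     depending on its own input inp, its own random seed s and the
     communication so far on its two incident links (hl = link j, hr = link j+1).
   - out s h : output of P_(k+1) from its seed and the communication on link k+1. *)
record protocol =
  dir :: "nat \<Rightarrow> bool list \<Rightarrow> bool"
  msg :: "nat \<Rightarrow> pinput \<Rightarrow> nat \<Rightarrow> nat \<Rightarrow> bool list \<Rightarrow> bool list \<Rightarrow> bool"
  out :: "nat \<Rightarrow> bool list \<Rightarrow> (nat \<Rightarrow> bit)"

fun hist :: "protocol \<Rightarrow> nat \<Rightarrow> (nat \<Rightarrow> pinput) \<Rightarrow> (nat \<Rightarrow> nat) \<Rightarrow> nat \<Rightarrow> nat \<Rightarrow> bool list" where
  "hist P k inp s 0 = (\<lambda>i. [])"
| "hist P k inp s (Suc t) =
     (let h = hist P k inp s t in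
      (\<lambda>i. if 1 \<le> i \<and> i \<le> k + 1 then
              h i @ [if dir P i (h i)
                     then msg P (i - 1) (inp (i - 1)) (s (i - 1)) i (h (i - 1)) (h i)
                     else msg P i (inp i) (s i) i (h i) (h (i + 1))]
            else []))"

definition success :: "protocol \<Rightarrow> nat \<Rightarrow> nat \<Rightarrow> nat \<Rightarrow> (nat \<Rightarrow> bit) \<Rightarrow> (nat \<Rightarrow> nat \<Rightarrow> nat \<Rightarrow> bit) \<Rightarrow> (nat \<Rightarrow> nat) \<Rightarrow> bool" where
  "success P N k T x A s \<longleftrightarrow>
     (\<forall>r<N. out P (s (k + 1)) (hist P k (player_input k x A) s T (k + 1)) r = chain N A k x r)"

definition success_prob :: "protocol \<Rightarrow> nat \<Rightarrow> nat \<Rightarrow> (nat \<Rightarrow> nat pmf) \<Rightarrow> nat \<Rightarrow> real" where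
  "success_prob P N k R T =
     measure_pmf.prob
       (pair_pmf (pair_pmf (pmf_of_set (vecs N)) (pmf_of_set ({1..k} \<rightarrow>\<^sub>E mats N)))
                 (Pi_pmf {0..k+1} 0 R))
       {((x, A), s). success P N k T x A s}"

end

theory Submission
  imports Defs
begin

text \<open>
  Fix the random seeds and write \<open>y\<^sub>i = A\<^sub>i \<dots> A\<^sub>1 x\<close>. The invariant is that after about \<open>N i / 4\<close> rounds
  the transcript of link \<open>i + 1\<close> does not even determine a list of \<open>2\<^bsup>N/2\<^esup>\<close> candidates that contains
  \<open>y\<^sub>i\<close> with noticeable probability. Then \<open>N / 4\<close> further rounds do not determine a list of
  \<open>2\<^bsup>N/4\<^esup>\<close> candidates, since one can take the union over all continuations. The matrix \<open>A\<^sub>i\<^sub>+\<^sub>1\<close>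
  restores the list size to \<open>2\<^bsup>N/2\<^esup>\<close>: because \<open>T = O(N\<^sup>2)\<close> with a small constant, the transcripts of
  the two links at player \<open>i + 1\<close> usually leave a set \<open>\<A>\<close> of at least \<open>2\<^bsup>N\<^sup>2 - \<delta>N\<^sup>2\<^esup>\<close> matrices,
  and for such a set and any list \<open>S\<close> of \<open>2\<^bsup>N/2\<^esup>\<close> vectors all but \<open>2\<^bsup>N/4\<^esup>\<close> vectors \<open>y\<close> are
  mapped into \<open>S\<close> by only an exponentially small fraction of \<open>\<A>\<close>. Otherwise many matrices would
  map many of \<open>2\<^bsup>N/4\<^esup>\<close> given vectors, hence \<open>N/8\<close> linearly independent ones, into \<open>S\<close>, and a union
  bound over the independent tuples excludes this.
\<close>

section \<open>Linear algebra over \<open>\<bbbF>\<^sub>2\<close>\<close>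

definition ip :: "nat \<Rightarrow> (nat \<Rightarrow> bit) \<Rightarrow> (nat \<Rightarrow> bit) \<Rightarrow> bit" where
  "ip N v y = (\<Sum>j<N. v j * y j)"

definition vadd :: "nat \<Rightarrow> (nat \<Rightarrow> bit) \<Rightarrow> (nat \<Rightarrow> bit) \<Rightarrow> (nat \<Rightarrow> bit)" where
  "vadd N y z = (\<lambda>i\<in>{0..<N}. y i + z i)"

text \<open>\<open>mvmul\<close> also has values at indices outside {0..<N}; cutting them off puts
  the product into \<open>vecs N\<close>, where equality of functions is equality of
  vectors.\<close>

definition mv :: "nat \<Rightarrow> (nat \<Rightarrow> nat \<Rightarrow> bit) \<Rightarrow> (nat \<Rightarrow> bit) \<Rightarrow> (nat \<Rightarrow> bit)" where
  "mv N M v = restrict (mvmul N M v) {0..<N}"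

fun lin_span :: "nat \<Rightarrow> (nat \<Rightarrow> bit) list \<Rightarrow> (nat \<Rightarrow> bit) set" where
  "lin_span N [] = {\<lambda>i\<in>{0..<N}. 0}"
| "lin_span N (y # ys) = lin_span N ys \<union> vadd N y ` lin_span N ys"

fun indep :: "nat \<Rightarrow> (nat \<Rightarrow> bit) list \<Rightarrow> bool" where
  "indep N [] \<longleftrightarrow> True"
| "indep N (y # ys) \<longleftrightarrow> y \<notin> lin_span N ys \<and> indep N ys"

text \<open>The candidates for one row of a matrix with prescribed images of \<open>ys\<close>: row
  \<open>r\<close> has as \<open>bs\<close> the \<open>r\<close>-th entries of these images.\<close>

definition solutions :: "nat \<Rightarrow> (nat \<Rightarrow> bit) list \<Rightarrow> bit list \<Rightarrow> (nat \<Rightarrow> bit) set" where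
  "solutions N ys bs = {v \<in> vecs N. map (ip N v) ys = bs}"

text \<open>The nontrivial additive character of F_2.\<close>

definition chi :: "bit \<Rightarrow> real" where
  "chi b = (if b = 0 then 1 else - 1)"

lemma UNIV_bit: "(UNIV :: bit set) = {0, 1}"
  using bit_not_one_iff by auto

lemma finite_vecs [simp]: "finite (vecs N)"
  by (auto simp: vecs_def UNIV_bit intro!: finite_PiE)

lemma finite_mats [simp]: "finite (mats N)"
  by (simp add: mats_def finite_PiE)

lemma card_vecs: "card (vecs N) = 2 ^ N"
  by (simp add: vecs_def card_PiE UNIV_bit flip: numeral_2_eq_2)

lemma card_mats: "card (mats N) = 2 ^ (N * N)"
  by (simp add: mats_def card_PiE card_vecs power_mult)

lemma mv_in_vecs [simp]: "mv N M v \<in> vecs N"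
  by (auto simp: mv_def vecs_def)

lemma vadd_in_vecs [simp]: "vadd N y z \<in> vecs N"
  by (auto simp: vadd_def vecs_def)

lemma vecs_eqI: "\<lbrakk>v \<in> vecs N; w \<in> vecs N; \<And>i. i < N \<Longrightarrow> v i = w i\<rbrakk> \<Longrightarrow> v = w"
  unfolding vecs_def by (rule PiE_ext) auto

lemma bit_add_self [simp]: "(b::bit) + (b + c) = c"
  by (cases b; cases c) auto

lemma vadd_cancel: "z \<in> vecs N \<Longrightarrow> vadd N y (vadd N y z) = z"
  by (rule vecs_eqI[of _ N], simp, simp) (simp add: vadd_def del: add_bit_eq_xor)

lemma lin_span_subset: "lin_span N ys \<subseteq> vecs N"
proof (induction ys)
  case Nil
  then show ?case by (auto simp: vecs_def)
qed auto

lemma finite_lin_span: "finite (lin_span N ys)"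
  by (rule finite_subset[OF lin_span_subset]) simp

lemma card_lin_span: "card (lin_span N ys) \<le> 2 ^ length ys"
proof (induction ys)
  case (Cons y ys)
  have "card (lin_span N (y # ys)) \<le> card (lin_span N ys) + card (vadd N y ` lin_span N ys)"
    by (simp add: card_Un_le)
  also have "\<dots> \<le> card (lin_span N ys) + card (lin_span N ys)"
    by (simp add: card_image_le finite_lin_span)
  finally show ?case using Cons by simp
qed simp

section \<open>Character sums and the number of solutions of linear systems\<close>

lemma chi_add: "chi (a + b) = chi a * chi b"
  by (cases a; cases b) (auto simp: chi_def)

lemma ip_vadd: "ip N v (vadd N y z) = ip N v y + ip N v z"
proof -
  have "ip N v (vadd N y z) = (\<Sum>j<N. v j * y j + v j * z j)"
    unfolding ip_def vadd_def by (rule sum.cong) (auto simp: algebra_simps)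
  then show ?thesis unfolding ip_def sum.distrib .
qed

text \<open>Some entry of \<open>y\<close> is 1, and flipping that coordinate of \<open>v\<close> is
  an involution of \<open>vecs N\<close> that changes the sign of every term.\<close>

lemma sum_chi_eq_0:
  assumes "y \<in> vecs N" "y \<noteq> (\<lambda>i\<in>{0..<N}. 0)"
  shows "(\<Sum>v\<in>vecs N. chi (ip N v y)) = 0"
proof -
  obtain i where i: "i < N" "y i \<noteq> 0"
  proof (rule ccontr)
    assume "\<not> thesis"
    with that have "\<And>i. i < N \<Longrightarrow> y i = 0" by blast
    then have "y = (\<lambda>i\<in>{0..<N}. 0)"
      using assms(1) by (intro vecs_eqI[of _ N]) (auto simp: vecs_def)
    with assms(2) show False by simp
  qed
  then have yi: "y i = 1" by (cases "y i") auto
  define f where "f = (\<lambda>v::nat \<Rightarrow> bit. v(i := v i + 1))"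
  have ff: "f (f v) = v" for v by (auto simp: f_def)
  have fv: "f v \<in> vecs N" if "v \<in> vecs N" for v
    using that i by (auto simp: f_def vecs_def PiE_def extensional_def)
  have ipf: "chi (ip N (f v) y) = - chi (ip N v y)" for v
  proof -
    have *: "ip N w y = w i * y i + (\<Sum>j\<in>{..<N} - {i}. w j * y j)" for w
      unfolding ip_def using i by (subst sum.remove[of _ i]) auto
    have "(\<Sum>j\<in>{..<N} - {i}. f v j * y j) = (\<Sum>j\<in>{..<N} - {i}. v j * y j)"
      by (rule sum.cong) (auto simp: f_def)
    moreover have "f v i = v i + 1" by (simp only: f_def fun_upd_same)
    ultimately have "ip N (f v) y = ip N v y + 1"
      unfolding *[of v] *[of "f v"] yi by (simp only: mult_1_right add.assoc add.commute[of 1])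
    then show ?thesis by (simp add: chi_add) (simp add: chi_def)
  qed
  have "(\<Sum>v\<in>vecs N. chi (ip N v y)) = (\<Sum>v\<in>vecs N. chi (ip N (f v) y))"
    by (rule sum.reindex_bij_witness[of _ f f]) (auto simp: ff fv)
  also have "\<dots> = - (\<Sum>v\<in>vecs N. chi (ip N v y))"
    by (simp add: ipf sum_negf)
  finally show ?thesis by simp
qed

lemma finite_solutions [simp]: "finite (solutions N ys bs)"
  by (simp add: solutions_def)

text \<open>The indicator of \<open>ip N v y = b\<close> is
  \<open>(1 + chi b * chi (ip N v y)) / 2\<close>.\<close>

lemma sum_solutions_Cons:
  fixes g :: "(nat \<Rightarrow> bit) \<Rightarrow> real"
  shows "(\<Sum>v\<in>solutions N (y # ys) (b # bs). g v)
    = (\<Sum>v\<in>solutions N ys bs. g v * (1 + chi b * chi (ip N v y)) / 2)"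
proof -
  have "solutions N (y # ys) (b # bs) = {v \<in> solutions N ys bs. ip N v y = b}"
    by (auto simp: solutions_def)
  then have "(\<Sum>v\<in>solutions N (y # ys) (b # bs). g v)
    = (\<Sum>v\<in>solutions N ys bs. if ip N v y = b then g v else 0)"
    by (simp add: sum.inter_filter)
  also have "\<dots> = (\<Sum>v\<in>solutions N ys bs. g v * (1 + chi b * chi (ip N v y)) / 2)"
    by (rule sum.cong) (auto simp: chi_def)
  finally show ?thesis .
qed

text \<open>Induction on the constraints: one more constraint, on \<open>z\<close>, turns the sum
  into half-weighted character sums at \<open>y\<close> and at \<open>z + y\<close>, up to sign, and
  both vanish by induction.\<close>

lemma sum_chi_solutions:
  assumes "y \<in> vecs N" "y \<notin> lin_span N ys" "length bs = length ys"
  shows "(\<Sum>v\<in>solutions N ys bs. chi (ip N v y)) = 0"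
  using assms
proof (induction ys arbitrary: y bs)
  case Nil
  then show ?case using sum_chi_eq_0[of y N] by (simp add: solutions_def)
next
  case (Cons z ys)
  then obtain b bs' where bs: "bs = b # bs'" and len: "length bs' = length ys"
    by (cases bs) auto
  \<comment> \<open>Otherwise \<open>y = z + (z + y)\<close> would lie in the span of
    \<open>z # ys\<close>.\<close>
  have "vadd N z y \<notin> lin_span N ys"
    using Cons.prems vadd_cancel[of y N z] by force
  then have 1: "(\<Sum>v\<in>solutions N ys bs'. chi (ip N v (vadd N z y))) = 0"
    using Cons len by simp
  have 2: "(\<Sum>v\<in>solutions N ys bs'. chi (ip N v y)) = 0"
    using Cons len by simp
  have "(\<Sum>v\<in>solutions N (z # ys) bs. chi (ip N v y))
    = (\<Sum>v\<in>solutions N ys bs'. 1/2 * chi (ip N v y) + chi b / 2 * chi (ip N v (vadd N z y)))"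
    unfolding bs sum_solutions_Cons
    by (rule sum.cong) (simp_all only: ip_vadd chi_add, simp add: field_simps)
  also have "\<dots> = 0"
    unfolding sum.distrib sum_distrib_left[symmetric] 1 2 by simp
  finally show ?case .
qed

text \<open>Each independent constraint halves the solution set, since the character term of its
  indicator sums to 0.\<close>

lemma card_solutions:
  assumes "indep N ys" "set ys \<subseteq> vecs N" "length bs = length ys"
  shows "real (card (solutions N ys bs)) = 2 ^ N / 2 ^ length ys"
  using assms
proof (induction ys arbitrary: bs)
  case Nil
  then show ?case by (simp add: solutions_def card_vecs)
next
  case (Cons y ys)
  then obtain b bs' where bs: "bs = b # bs'" and len: "length bs' = length ys"
    by (cases bs) auto
  have "real (card (solutions N (y # ys) bs)) = (\<Sum>v\<in>solutions N (y # ys) bs. 1)" by simp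
  also have "\<dots> = (\<Sum>v\<in>solutions N ys bs'. 1/2 + chi b / 2 * chi (ip N v y))"
    unfolding bs sum_solutions_Cons by (rule sum.cong) (auto simp: field_simps)
  also have "\<dots> = real (card (solutions N ys bs')) / 2"
    unfolding sum.distrib sum_distrib_left[symmetric]
    using sum_chi_solutions[of y N ys bs'] Cons.prems len by simp
  also have "\<dots> = 2 ^ N / 2 ^ length (y # ys)"
    using Cons len by simp
  finally show ?case .
qed

section \<open>Matrices that map many vectors into a small set\<close>

text \<open>Greedy choice: the span of \<open>m\<close> vectors has at most \<open>2 ^ m\<close>
  elements and so cannot cover a set of \<open>2 ^ Suc m\<close> vectors.\<close>

lemma ex_indep_list:
  assumes "finite Y" "2 ^ m \<le> card Y"
  shows "\<exists>ys. indep N ys \<and> set ys \<subseteq> Y \<and> length ys = m"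
  using assms
proof (induction m)
  case 0
  then show ?case by (intro exI[of _ "[]"]) simp
next
  case (Suc m)
  then obtain ys where ys: "indep N ys" "set ys \<subseteq> Y" "length ys = m" by auto
  have "\<not> Y \<subseteq> lin_span N ys"
  proof
    assume "Y \<subseteq> lin_span N ys"
    then have "card Y \<le> card (lin_span N ys)" by (rule card_mono[OF finite_lin_span])
    also have "\<dots> \<le> 2 ^ m" using card_lin_span[of N ys] ys by simp
    finally show False using Suc.prems power_strict_increasing[of m "Suc m" "2::nat"] by linarith
  qed
  then obtain y where "y \<in> Y" "y \<notin> lin_span N ys" by blast
  with ys show ?case by (intro exI[of _ "y # ys"]) auto
qed

text \<open>The condition splits over the rows: row \<open>r\<close> solves the linear system with
  right-hand sides the \<open>r\<close>-th entries of \<open>zs\<close>.\<close>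

lemma card_mats_mapping_list:
  assumes ys: "indep N ys" "set ys \<subseteq> vecs N" "length zs = length ys"
  shows "real (card {M \<in> mats N. map (mv N M) ys = zs}) \<le> (2 ^ N / 2 ^ length ys) ^ N"
proof -
  let ?R = "\<lambda>r. solutions N ys (map (\<lambda>z. z r) zs)"
  have "{M \<in> mats N. map (mv N M) ys = zs} \<subseteq> PiE {0..<N} ?R"
  proof
    fix M assume M: "M \<in> {M \<in> mats N. map (mv N M) ys = zs}"
    have "M r \<in> ?R r" if "r < N" for r
    proof -
      have "M r \<in> vecs N" using M that by (auto simp: mats_def)
      moreover have "map (ip N (M r)) ys = map (\<lambda>z. z r) (map (mv N M) ys)"
        using that by (auto simp: ip_def mv_def mvmul_def)
      ultimately show ?thesis using M by (auto simp: solutions_def)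
    qed
    then show "M \<in> PiE {0..<N} ?R" using M by (auto simp: mats_def PiE_def)
  qed
  then have "card {M \<in> mats N. map (mv N M) ys = zs} \<le> card (PiE {0..<N} ?R)"
    by (rule card_mono[rotated]) (simp add: finite_PiE)
  then have "real (card {M \<in> mats N. map (mv N M) ys = zs}) \<le> (\<Prod>r = 0..<N. real (card (?R r)))"
    by (simp add: card_PiE flip: of_nat_prod)
  also have "\<dots> = (\<Prod>r = 0..<N. 2 ^ N / 2 ^ length ys)"
    by (rule prod.cong) (use ys in \<open>auto simp: card_solutions\<close>)
  finally show ?thesis by simp
qed

text \<open>Any \<open>2 ^ m\<close> vectors sent into \<open>S\<close> include \<open>m\<close>
  independent ones; the union bound runs over independent tuples in \<open>B\<close> and image
  tuples in \<open>S\<close>.\<close>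

lemma card_mats_mapping_into:
  assumes B: "B \<subseteq> vecs N" and S: "S \<subseteq> vecs N"
  shows "real (card {M \<in> mats N. 2 ^ m \<le> card {y \<in> B. mv N M y \<in> S}})
    \<le> (real (card B) * real (card S)) ^ m * (2 ^ N / 2 ^ m) ^ N"
proof -
  have fin: "finite B" "finite S" using B S finite_subset finite_vecs by blast+
  let ?L = "\<lambda>X::(nat \<Rightarrow> bit) set. {ys. set ys \<subseteq> X \<and> length ys = m}"
  let ?I = "{ys \<in> ?L B. indep N ys}"
  let ?E = "\<lambda>(ys, zs). {M \<in> mats N. map (mv N M) ys = zs}"
  have finL: "finite (?L B)" "finite (?L S)" using fin finite_lists_length_eq by auto
  then have finI: "finite (?I \<times> ?L S)" by (intro finite_cartesian_product finite_subset[of ?I "?L B"]) auto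
  have "{M \<in> mats N. 2 ^ m \<le> card {y \<in> B. mv N M y \<in> S}} \<subseteq> (\<Union>p\<in>?I \<times> ?L S. ?E p)"
  proof
    fix M assume M: "M \<in> {M \<in> mats N. 2 ^ m \<le> card {y \<in> B. mv N M y \<in> S}}"
    then obtain ys where ys: "indep N ys" "set ys \<subseteq> {y \<in> B. mv N M y \<in> S}" "length ys = m"
      using ex_indep_list[of "{y \<in> B. mv N M y \<in> S}" m N] fin by auto
    then have "(ys, map (mv N M) ys) \<in> ?I \<times> ?L S" by auto
    with M show "M \<in> (\<Union>p\<in>?I \<times> ?L S. ?E p)" by blast
  qed
  then have "card {M \<in> mats N. 2 ^ m \<le> card {y \<in> B. mv N M y \<in> S}} \<le> card (\<Union>p\<in>?I \<times> ?L S. ?E p)"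
    by (rule card_mono[rotated]) (auto intro!: finite_subset[OF _ finite_mats[of N]])
  also have "\<dots> \<le> (\<Sum>p\<in>?I \<times> ?L S. card (?E p))"
    by (rule card_UN_le[OF finI])
  finally have "real (card {M \<in> mats N. 2 ^ m \<le> card {y \<in> B. mv N M y \<in> S}})
      \<le> (\<Sum>p\<in>?I \<times> ?L S. real (card (?E p)))"
    by (simp flip: of_nat_sum)
  also have "\<dots> \<le> (\<Sum>p\<in>?I \<times> ?L S. (2 ^ N / 2 ^ m) ^ N)"
  proof (rule sum_mono)
    fix p assume p: "p \<in> ?I \<times> ?L S"
    obtain ys zs where p_eq: "p = (ys, zs)" by (cases p)
    have "real (card {M \<in> mats N. map (mv N M) ys = zs}) \<le> (2 ^ N / 2 ^ length ys) ^ N"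
      using p B by (intro card_mats_mapping_list) (auto simp: p_eq)
    then show "real (card (?E p)) \<le> (2 ^ N / 2 ^ m) ^ N" using p by (simp add: p_eq)
  qed
  also have "\<dots> = real (card ?I) * real (card (?L S)) * (2 ^ N / 2 ^ m) ^ N"
    by (simp add: card_cartesian_product)
  also have "\<dots> \<le> real (card (?L B)) * real (card (?L S)) * (2 ^ N / 2 ^ m) ^ N"
    using finL by (intro mult_right_mono of_nat_mono card_mono) auto
  also have "\<dots> = (real (card B) * real (card S)) ^ m * (2 ^ N / 2 ^ m) ^ N"
    by (simp add: card_lists_length_eq fin power_mult_distrib)
  finally show ?thesis .
qed

text \<open>Here \<open>q\<close> stands for N/8. With too many exceptional vectors,
  \<open>2 ^ (2 * q)\<close> of them would form a set \<open>B\<close>, and by averaging at least a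
  fraction \<open>1 / 2 ^ q\<close> of \<A> would send \<open>2 ^ q\<close> vectors of
  \<open>B\<close> into \<open>S\<close>. The union bound over independent tuples leaves too few
  matrices for that.\<close>

lemma card_concentrated_le:
  assumes q: "8 * q \<le> N" and A: "\<A> \<subseteq> mats N" and S: "S \<subseteq> vecs N" "card S \<le> 2 ^ (4 * q)"
    and big: "real (card \<A>) > 2 ^ (N * N) * 2 ^ q / 2 ^ (2 * q * q)"
  shows "card {y \<in> vecs N. real (card {M \<in> \<A>. mv N M y \<in> S}) > 2 / 2 ^ q * real (card \<A>)} \<le> 2 ^ (2 * q)"
    (is "card ?B \<le> _")
proof (rule ccontr)
  assume "\<not> ?thesis"
  then have "2 ^ (2 * q) \<le> card ?B" by simp
  then obtain B where B: "B \<subseteq> ?B" "card B = 2 ^ (2 * q)"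
    by (rule obtain_subset_with_card_n)
  have finA: "finite \<A>" using A finite_subset finite_mats by blast
  have finB: "finite B" using B finite_subset[of B "vecs N"] by auto
  let ?n = "\<lambda>M. card {y \<in> B. mv N M y \<in> S}"
  have pq: "(2::real) ^ (2 * q) = 2 ^ q * 2 ^ q" by (simp add: mult_2 power_add)
  let ?G = "{M \<in> mats N. 2 ^ q \<le> ?n M}"
  \<comment> \<open>Double counting of the pairs of \<open>y\<close> in \<open>B\<close> and
    \<open>M\<close> in \<A> with \<open>mv N M y \<in> S\<close>.\<close>
  have "real (card \<A>) * 2 * 2 ^ q = (\<Sum>y\<in>B. 2 / 2 ^ q * real (card \<A>))"
    using B by (simp add: pq)
  also have "\<dots> \<le> (\<Sum>y\<in>B. real (card {M \<in> \<A>. mv N M y \<in> S}))"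
    using B by (intro sum_mono) auto
  also have "\<dots> = (\<Sum>M\<in>\<A>. real (?n M))"
    using sum_multicount_gen[of B \<A> "\<lambda>y M. mv N M y \<in> S" ?n] finA finB by (simp flip: of_nat_sum)
  also have "\<dots> \<le> (\<Sum>M\<in>\<A>. 2 ^ q + (if M \<in> ?G then 2 ^ (2 * q) else 0))"
  proof (rule sum_mono)
    fix M assume M: "M \<in> \<A>"
    have "?n M \<le> 2 ^ (2 * q)" using card_mono[of B "{y \<in> B. mv N M y \<in> S}"] finB B by auto
    then have "real (?n M) \<le> real (2 ^ (2 * q))" by (simp only: of_nat_le_iff)
    moreover have "real (?n M) < real (2 ^ q)" if "M \<notin> ?G"
      using that M A by (simp only: of_nat_less_iff) auto
    ultimately show "real (?n M) \<le> 2 ^ q + (if M \<in> ?G then 2 ^ (2 * q) else 0)"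
      by (cases "M \<in> ?G") (simp_all del: mem_Collect_eq add: add_increasing)
  qed
  also have "\<dots> = real (card \<A>) * 2 ^ q + real (card (\<A> \<inter> ?G)) * 2 ^ (2 * q)"
    unfolding sum.distrib sum.If_cases[OF finA] by simp
  also have "\<dots> \<le> real (card \<A>) * 2 ^ q + real (card ?G) * 2 ^ (2 * q)"
    by (intro add_left_mono mult_right_mono of_nat_mono card_mono) auto
  finally have "real (card \<A>) * 2 ^ q \<le> (real (card ?G) * 2 ^ q) * 2 ^ q"
    by (simp add: pq mult.assoc)
  then have 1: "real (card \<A>) \<le> real (card ?G) * 2 ^ q" by simp
  have "real (card ?G) \<le> (real (card B) * real (card S)) ^ q * (2 ^ N / 2 ^ q) ^ N"
    using card_mats_mapping_into[of B N S q] B S by auto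
  also have "\<dots> \<le> (2 ^ (2 * q) * 2 ^ (4 * q)) ^ q * (2 ^ N / 2 ^ q) ^ N"
  proof -
    have "real (card B) = 2 ^ (2 * q)" using B by simp
    moreover have "real (card S) \<le> real (2 ^ (4 * q))" using S by (simp only: of_nat_le_iff)
    ultimately show ?thesis by (intro mult_right_mono power_mono mult_mono) auto
  qed
  also have "\<dots> = 2 ^ (N * N) * (2 ^ (6 * q * q) / 2 ^ (q * N))"
  proof -
    have "(2 ^ (2 * q) * 2 ^ (4 * q) :: real) ^ q = 2 ^ (6 * q * q)"
      by (simp flip: power_add power_mult)
    moreover have "(2 ^ N / 2 ^ q :: real) ^ N = 2 ^ (N * N) / 2 ^ (q * N)"
      by (simp add: power_divide flip: power_mult)
    ultimately show ?thesis by simp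
  qed
  \<comment> \<open>By \<open>8 * q \<le> N\<close> the saving \<open>2 ^ (q * N)\<close> exceeds
    the bound \<open>2 ^ (6 * q * q)\<close> on the number of tuple pairs by a factor of at least
    \<open>2 ^ (2 * q * q)\<close>.\<close>
  also have "\<dots> \<le> 2 ^ (N * N) * (2 ^ (6 * q * q) / 2 ^ (8 * q * q))"
    using mult_le_mono2[OF q, of q]
    by (intro mult_left_mono divide_left_mono power_increasing) (auto simp: algebra_simps)
  also have "\<dots> = 2 ^ (N * N) / 2 ^ (2 * q * q)"
  proof -
    have "8 * q * q = 6 * q * q + 2 * q * q" by simp
    then have "(2::real) ^ (8 * q * q) = 2 ^ (6 * q * q) * 2 ^ (2 * q * q)" by (metis power_add)
    then show ?thesis by simp
  qed
  finally have "real (card ?G) * 2 ^ q \<le> 2 ^ (N * N) / 2 ^ (2 * q * q) * 2 ^ q"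
    by (intro mult_right_mono) auto
  with 1 big show False by simp
qed

section \<open>Transcripts\<close>

lemma length_hist: "1 \<le> i \<Longrightarrow> i \<le> k + 1 \<Longrightarrow> length (hist P k inp s t i) = t"
  by (induction t) (auto simp: Let_def)

lemma hist_prefix: "1 \<le> i \<Longrightarrow> i \<le> k + 1 \<Longrightarrow> take t (hist P k inp s (t + d) i) = hist P k inp s t i"
  by (induction d) (auto simp: Let_def length_hist)

text \<open>Link \<open>c\<close> cuts the line, and each side sees the other only through the
  transcript of \<open>c\<close>. Joining the left inputs of one run to the right inputs of another
  with the same transcript therefore reproduces each run on its side.\<close>

lemma hist_cut_paste:
  assumes c: "1 \<le> c" "c \<le> k + 1"
    and eq: "hist P k inp1 s t c = hist P k inp2 s t c"
    and left: "\<And>j. j < c \<Longrightarrow> inp3 j = inp1 j" and right: "\<And>j. c \<le> j \<Longrightarrow> inp3 j = inp2 j"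
  shows "(\<forall>j\<le>c. hist P k inp3 s t j = hist P k inp1 s t j) \<and> (\<forall>j\<ge>c. hist P k inp3 s t j = hist P k inp2 s t j)"
  using eq
proof (induction t)
  case 0
  then show ?case by simp
next
  case (Suc t)
  have e: "hist P k inp1 s t c = hist P k inp2 s t c"
    using Suc.prems hist_prefix[OF c, of t P inp1 s 1] hist_prefix[OF c, of t P inp2 s 1] by simp
  note IH = Suc.IH[OF e]
  then have IL: "\<And>j. j \<le> c \<Longrightarrow> hist P k inp3 s t j = hist P k inp1 s t j"
    and IR: "\<And>j. j \<ge> c \<Longrightarrow> hist P k inp3 s t j = hist P k inp2 s t j" by auto
  have L: "hist P k inp3 s (Suc t) j = hist P k inp1 s (Suc t) j" if "j < c" for j
    using that c by (auto simp: Let_def IL left)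
  have R: "hist P k inp3 s (Suc t) j = hist P k inp2 s (Suc t) j" if "j > c" for j
    using that c by (auto simp: Let_def IR right)
  have C: "hist P k inp3 s (Suc t) c = hist P k inp1 s (Suc t) c"
  \<comment> \<open>The common history fixes the sender. A left sender acts as under
    \<open>inp1\<close>; a right sender acts as under \<open>inp2\<close>, whose transcript of
    \<open>c\<close> agrees with that under \<open>inp1\<close> by assumption.\<close>
  proof (cases "dir P c (hist P k inp1 s t c)")
    case True
    then show ?thesis using c by (simp add: Let_def IL left)
  next
    case False
    then have "hist P k inp3 s (Suc t) c = hist P k inp2 s (Suc t) c"
      using c e by (simp add: Let_def IR right)
    with Suc.prems show ?thesis by (simp only:)
  qed
  show ?case
  proof (intro conjI allI impI)
    fix j
    show "hist P k inp3 s (Suc t) j = hist P k inp1 s (Suc t) j" if "j \<le> c"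
      using that L C by (cases "j = c") (simp_all del: hist.simps)
    show "hist P k inp3 s (Suc t) j = hist P k inp2 s (Suc t) j" if "j \<ge> c"
      using that R C Suc.prems by (cases "j = c") (simp_all del: hist.simps)
  qed
qed

section \<open>Guessing from a transcript\<close>

text \<open>The guessed pairs are split according to whether the fibre of matrices compatible with
  the two transcripts is small, whether \<open>y l\<close> belongs to the exceptional list of that fibre, or
  neither. By \<open>rect\<close> a fibre does not depend on \<open>l\<close>.\<close>

lemma card_guess_step:
  fixes a b :: "'l \<Rightarrow> 'm \<Rightarrow> 'h" and y :: "'l \<Rightarrow> 'v" and G :: "'h \<Rightarrow> 'm \<Rightarrow> 'v \<Rightarrow> bool"
    and e p \<eta> :: real
  assumes fin: "finite \<Omega>" "finite \<M>" "finite H" and pos: "0 \<le> p" "0 \<le> \<eta>"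
    and ab: "\<And>l M. l \<in> \<Omega> \<Longrightarrow> M \<in> \<M> \<Longrightarrow> a l M \<in> H \<and> b l M \<in> H"
    and y: "\<And>l. l \<in> \<Omega> \<Longrightarrow> y l \<in> V"
    and rect: "\<And>l l' M M'. \<lbrakk>l \<in> \<Omega>; l' \<in> \<Omega>; M \<in> \<M>; M' \<in> \<M>; a l M = a l' M'\<rbrakk>
      \<Longrightarrow> a l M' = a l' M' \<and> b l M' = b l' M'"
    and spread: "\<And>\<A> h. \<A> \<subseteq> \<M> \<Longrightarrow> real (card \<A>) > \<eta>
      \<Longrightarrow> card {v \<in> V. real (card {M \<in> \<A>. G h M v}) > p * real (card \<A>)} \<le> K"
    and guess: "\<And>M F. \<lbrakk>M \<in> \<M>; \<And>h. F h \<subseteq> V; \<And>h. card (F h) \<le> K\<rbrakk>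
      \<Longrightarrow> real (card {l \<in> \<Omega>. y l \<in> F (a l M)}) \<le> e * real (card \<Omega>)"
  shows "real (card {(l, M) \<in> \<Omega> \<times> \<M>. G (b l M) M (y l)})
    \<le> (e + p) * (real (card \<Omega>) * real (card \<M>)) + real (card \<Omega>) * (real (card H) ^ 2 * \<eta>)"
proof -
  \<comment> \<open>In the application \<open>l\<close> is the left input, \<open>M\<close> the next
    matrix, and \<open>a\<close>, \<open>b\<close> are the transcripts of the two links at the
    player holding \<open>M\<close>.\<close>
  define fib where "fib = (\<lambda>g h. {M \<in> \<M>. \<exists>l\<in>\<Omega>. a l M = g \<and> b l M = h})"
  \<comment> \<open>Empty for small fibres, where \<open>spread\<close> gives no bound.\<close>
  define B where "B = (\<lambda>g h. if real (card (fib g h)) > \<eta>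
    then {v \<in> V. real (card {M \<in> fib g h. G h M v}) > p * real (card (fib g h))} else {})"
  have fib_sub: "fib g h \<subseteq> \<M>" for g h by (auto simp: fib_def)
  have fin_fib [simp]: "finite (fib g h)" for g h using fib_sub fin finite_subset by blast
  have fib_l: "fib (a l M) (b l M) = {M' \<in> \<M>. a l M' = a l M \<and> b l M' = b l M}"
    if l: "l \<in> \<Omega>" and M: "M \<in> \<M>" for l M
  proof -
    \<comment> \<open>A matrix of the fibre comes with its own witness \<open>l'\<close>; by
      \<open>rect\<close>, \<open>l\<close> yields the same two transcripts with it.\<close>
    have "a l M' = a l M \<and> b l M' = b l M" if M': "M' \<in> fib (a l M) (b l M)" for M'
    proof -
      obtain l' where l': "l' \<in> \<Omega>" "M' \<in> \<M>" "a l' M' = a l M" "b l' M' = b l M"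
        using M' unfolding fib_def by auto
      show ?thesis using rect[OF l l'(1) M l'(2)] l' by simp
    qed
    then have "fib (a l M) (b l M) \<subseteq> {M' \<in> \<M>. a l M' = a l M \<and> b l M' = b l M}"
      using fib_sub by blast
    moreover have "{M' \<in> \<M>. a l M' = a l M \<and> b l M' = b l M} \<subseteq> fib (a l M) (b l M)"
      using l unfolding fib_def by blast
    ultimately show ?thesis by (rule equalityI)
  qed
  let ?X = "{(l, M) \<in> \<Omega> \<times> \<M>. G (b l M) M (y l)}"
  let ?X1 = "{(l, M) \<in> \<Omega> \<times> \<M>. y l \<in> B (a l M) (b l M)}"
  let ?X2 = "{(l, M) \<in> \<Omega> \<times> \<M>. real (card (fib (a l M) (b l M))) \<le> \<eta>}"
  let ?X3 = "{(l, M) \<in> \<Omega> \<times> \<M>. G (b l M) M (y l)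
    \<and> real (card {M' \<in> fib (a l M) (b l M). G (b l M) M' (y l)}) \<le> p * real (card (fib (a l M) (b l M)))}"
  have finX: "finite ?X1" "finite ?X2" "finite ?X3"
    by (rule finite_subset[OF _ finite_cartesian_product[OF fin(1,2)]]; blast)+
  have "?X \<subseteq> ?X1 \<union> ?X2 \<union> ?X3"
  proof (rule subsetI)
    fix z assume "z \<in> ?X"
    then obtain l M where z: "z = (l, M)" "l \<in> \<Omega>" "M \<in> \<M>" "G (b l M) M (y l)" by blast
    have "y l \<in> B (a l M) (b l M)"
      if "\<not> real (card (fib (a l M) (b l M))) \<le> \<eta>"
        "\<not> real (card {M' \<in> fib (a l M) (b l M). G (b l M) M' (y l)}) \<le> p * real (card (fib (a l M) (b l M)))"
      using that y[OF z(2)] by (simp add: B_def not_le)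
    with z show "z \<in> ?X1 \<union> ?X2 \<union> ?X3" by blast
  qed
  then have "card ?X \<le> card (?X1 \<union> ?X2 \<union> ?X3)" by (rule card_mono[rotated]) (use finX in auto)
  also have "\<dots> \<le> card ?X1 + card ?X2 + card ?X3"
    using card_Un_le[of "?X1 \<union> ?X2" ?X3] card_Un_le[of ?X1 ?X2] by linarith
  finally have X: "real (card ?X) \<le> real (card ?X1) + real (card ?X2) + real (card ?X3)"
    by (simp flip: of_nat_add)
  have by_l: "card {(l, M) \<in> \<Omega> \<times> \<M>. Q l M} = (\<Sum>l\<in>\<Omega>. card {M \<in> \<M>. Q l M})" for Q
  proof -
    have "{(l, M) \<in> \<Omega> \<times> \<M>. Q l M} = (SIGMA l:\<Omega>. {M \<in> \<M>. Q l M})" by auto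
    then show ?thesis using fin by simp
  qed
  have by_M: "card {(l, M) \<in> \<Omega> \<times> \<M>. Q l M} = (\<Sum>M\<in>\<M>. card {l \<in> \<Omega>. Q l M})" for Q
    unfolding by_l using sum_multicount_gen[of \<Omega> \<M> Q] fin by simp
  have X1: "real (card ?X1) \<le> e * (real (card \<Omega>) * real (card \<M>))"
  proof -
    have "real (card {l \<in> \<Omega>. y l \<in> B (a l M) (b l M)}) \<le> e * real (card \<Omega>)" if M: "M \<in> \<M>" for M
    proof -
      \<comment> \<open>The guesser sees only \<open>a l M\<close>, but for fixed \<open>M\<close>
        this determines \<open>b l M\<close> by \<open>rect\<close>, so any left input with that
        transcript recovers the second index of \<open>B\<close>. For values \<open>h\<close> that
        do not occur the choice is arbitrary; the bounds hold for every
        \<open>B g h\<close>.\<close>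
      define F where "F = (\<lambda>h. B h (b (SOME l. l \<in> \<Omega> \<and> a l M = h) M))"
      have "B (a l M) (b l M) = F (a l M)" if l: "l \<in> \<Omega>" for l
      proof -
        let ?l = "SOME l'. l' \<in> \<Omega> \<and> a l' M = a l M"
        have "?l \<in> \<Omega> \<and> a ?l M = a l M" by (rule someI[of _ l]) (use l in simp)
        then have "b ?l M = b l M" using rect[of ?l l M M] l M by simp
        then show ?thesis by (simp add: F_def)
      qed
      then have "{l \<in> \<Omega>. y l \<in> B (a l M) (b l M)} = {l \<in> \<Omega>. y l \<in> F (a l M)}" by auto
      moreover have "B g h \<subseteq> V" "card (B g h) \<le> K" for g h
        using spread[OF fib_sub] by (auto simp: B_def)
      ultimately show ?thesis using guess[OF M, of F] by (simp add: F_def)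
    qed
    then have "(\<Sum>M\<in>\<M>. real (card {l \<in> \<Omega>. y l \<in> B (a l M) (b l M)})) \<le> (\<Sum>M\<in>\<M>. e * real (card \<Omega>))"
      by (rule sum_mono)
    then show ?thesis unfolding by_M by (simp add: algebra_simps)
  qed
  have X2: "real (card ?X2) \<le> real (card \<Omega>) * (real (card H) ^ 2 * \<eta>)"
  proof -
    have "real (card {M \<in> \<M>. real (card (fib (a l M) (b l M))) \<le> \<eta>}) \<le> real (card H) ^ 2 * \<eta>"
      if l: "l \<in> \<Omega>" for l
    proof -
      let ?J = "{(g, h) \<in> H \<times> H. real (card (fib g h)) \<le> \<eta>}"
      have finJ: "finite ?J" by (rule finite_subset[of _ "H \<times> H"]) (use fin in auto)
      have "{M \<in> \<M>. real (card (fib (a l M) (b l M))) \<le> \<eta>} \<subseteq> (\<Union>(g, h)\<in>?J. fib g h)"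
        using l ab by (auto simp: fib_def)
      then have "card {M \<in> \<M>. real (card (fib (a l M) (b l M))) \<le> \<eta>} \<le> card (\<Union>(g, h)\<in>?J. fib g h)"
        by (rule card_mono[rotated]) (use finJ in auto)
      also have "\<dots> \<le> (\<Sum>(g, h)\<in>?J. card (fib g h))"
        using card_UN_le[OF finJ, of "\<lambda>(g, h). fib g h"] by (simp add: case_prod_unfold)
      finally have "real (card {M \<in> \<M>. real (card (fib (a l M) (b l M))) \<le> \<eta>})
          \<le> (\<Sum>z\<in>?J. real (card (fib (fst z) (snd z))))"
        by (simp add: case_prod_unfold flip: of_nat_sum)
      also have "\<dots> \<le> (\<Sum>z\<in>?J. \<eta>)" by (rule sum_mono) auto
      also have "\<dots> \<le> real (card (H \<times> H)) * \<eta>"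
        using pos fin by (simp only: sum_constant) (intro mult_right_mono of_nat_mono card_mono; auto)
      finally show ?thesis by (simp add: card_cartesian_product power2_eq_square)
    qed
    then have "(\<Sum>l\<in>\<Omega>. real (card {M \<in> \<M>. real (card (fib (a l M) (b l M))) \<le> \<eta>}))
        \<le> (\<Sum>l\<in>\<Omega>. real (card H) ^ 2 * \<eta>)" by (rule sum_mono)
    then show ?thesis unfolding by_l by simp
  qed
  have X3: "real (card ?X3) \<le> p * (real (card \<Omega>) * real (card \<M>))"
  proof -
    have "real (card {M \<in> \<M>. G (b l M) M (y l) \<and> real (card {M' \<in> fib (a l M) (b l M). G (b l M) M' (y l)})
        \<le> p * real (card (fib (a l M) (b l M)))}) \<le> p * real (card \<M>)" (is "real (card ?S) \<le> _")
      if l: "l \<in> \<Omega>" for l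
    proof -
      let ?ab = "\<lambda>M. (a l M, b l M)"
      have finS: "finite ?S" using fin by simp
      have split: "card T = (\<Sum>z\<in>?ab ` \<M>. card {M \<in> T. ?ab M = z})" if "T \<subseteq> \<M>" for T
        using sum.group[OF finite_subset[OF that fin(2)] finite_imageI[OF fin(2)] image_mono[OF that], of "\<lambda>_. 1::nat" ?ab]
        by simp
      \<comment> \<open>For fixed \<open>l\<close> the transcript pairs partition \<M>. By
        \<open>fib_l\<close> each class that meets \<open>?S\<close> is a whole fibre, in which at
        most a fraction \<open>p\<close> satisfies \<open>G\<close>.\<close>
      have "real (card ?S) = (\<Sum>z\<in>?ab ` \<M>. real (card {M \<in> ?S. ?ab M = z}))"
        by (subst split) auto
      also have "\<dots> \<le> (\<Sum>z\<in>?ab ` \<M>. p * real (card {M \<in> \<M>. ?ab M = z}))"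
      proof (rule sum_mono)
        fix z assume "z \<in> ?ab ` \<M>"
        show "real (card {M \<in> ?S. ?ab M = z}) \<le> p * real (card {M \<in> \<M>. ?ab M = z})"
        proof (cases "{M \<in> ?S. ?ab M = z} = {}")
          case True
          then have "real (card {M \<in> ?S. ?ab M = z}) = 0" by (simp only: card.empty of_nat_0)
          then show ?thesis using pos by simp
        next
          case False
          then obtain M where M: "M \<in> ?S" "?ab M = z" by blast
          then have zab: "fst z = a l M" "snd z = b l M" "M \<in> \<M>" by auto
          have f: "fib (fst z) (snd z) = {M \<in> \<M>. ?ab M = z}"
            unfolding M(2)[symmetric] by (simp add: fib_l[OF l zab(3)])
          have "{M \<in> ?S. ?ab M = z} \<subseteq> {M' \<in> fib (fst z) (snd z). G (snd z) M' (y l)}"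
            unfolding f by force
          then have "card {M \<in> ?S. ?ab M = z} \<le> card {M' \<in> fib (fst z) (snd z). G (snd z) M' (y l)}"
            by (rule card_mono[rotated]) auto
          also have "real \<dots> \<le> p * real (card (fib (fst z) (snd z)))"
            unfolding zab(1,2) using M(1) by blast
          finally show ?thesis unfolding f by simp
        qed
      qed
      also have "\<dots> = p * real (card \<M>)"
        by (simp add: split[of \<M>] sum_distrib_left)
      finally show ?thesis .
    qed
    then have "(\<Sum>l\<in>\<Omega>. real (card {M \<in> \<M>. G (b l M) M (y l) \<and> real (card {M' \<in> fib (a l M) (b l M). G (b l M) M' (y l)})
        \<le> p * real (card (fib (a l M) (b l M)))})) \<le> (\<Sum>l\<in>\<Omega>. p * real (card \<M>))" by (rule sum_mono)
    then show ?thesis unfolding by_l by (simp add: algebra_simps)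
  qed
  show ?thesis using X X1 X2 X3 by (simp add: algebra_simps)
qed

section \<open>Inputs to the left of a link and their partial products\<close>

definition left_inputs :: "nat \<Rightarrow> nat \<Rightarrow> ((nat \<Rightarrow> bit) \<times> (nat \<Rightarrow> nat \<Rightarrow> nat \<Rightarrow> bit)) set" where
  "left_inputs N i = vecs N \<times> ({1..i} \<rightarrow>\<^sub>E mats N)"

definition glue :: "nat \<Rightarrow> (nat \<Rightarrow> 'a) \<Rightarrow> (nat \<Rightarrow> 'a) \<Rightarrow> nat \<Rightarrow> 'a" where
  "glue i A \<rho> = (\<lambda>j. if j \<le> i then A j else \<rho> j)"

definition link_hist where
  "link_hist P k s t i j l \<rho> = hist P k (player_input k (fst l) (glue i (snd l) \<rho>)) s t j"

definition partial_product where
  "partial_product N i l = restrict (chain N (snd l) i (fst l)) {0..<N}"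

text \<open>The guesser may know the inputs \<open>\<rho>\<close> to the right of the link. This makes the transcript of
  the next link a function of the transcript of this one and of \<open>A\<^sub>i\<^sub>+\<^sub>1\<close>.\<close>

definition hard_to_guess where
  "hard_to_guess P N k s i t L e \<longleftrightarrow> (\<forall>\<rho> F. (\<forall>h. F h \<subseteq> vecs N \<and> card (F h) \<le> L) \<longrightarrow>
     real (card {l \<in> left_inputs N i. partial_product N i l \<in> F (link_hist P k s t i (Suc i) l \<rho>)})
       \<le> e * real (card (left_inputs N i)))"

lemma finite_left_inputs [simp]: "finite (left_inputs N i)"
  by (simp add: left_inputs_def finite_PiE)

lemma chain_cong: "(\<And>j. 1 \<le> j \<Longrightarrow> j \<le> i \<Longrightarrow> A j = A' j) \<Longrightarrow> chain N A i x = chain N A' i x"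
  by (induction i) auto

lemma mv_restrict: "mv N M (restrict v {0..<N}) = mv N M v"
  by (auto simp: mv_def mvmul_def intro!: restrict_ext sum.cong)

lemma partial_product_Suc:
  "partial_product N (Suc i) (x, A(Suc i := M)) = mv N M (partial_product N i (x, A))"
proof -
  have "chain N (A(Suc i := M)) i x = chain N A i x" by (rule chain_cong) auto
  then show ?thesis by (simp add: partial_product_def mv_restrict) (simp add: mv_def)
qed

text \<open>Identifies the pairs counted in \<open>card_guess_step\<close> with the inputs to the
  left of the next link.\<close>

lemma left_inputs_Suc_bij:
  "bij_betw (\<lambda>(l, M). (fst l, (snd l)(Suc i := M))) (left_inputs N i \<times> mats N) (left_inputs N (Suc i))"
proof (rule bij_betw_imageI)
  show "inj_on (\<lambda>(l, M). (fst l, (snd l)(Suc i := M))) (left_inputs N i \<times> mats N)"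
  proof (rule inj_onI)
    fix z z' :: "((nat \<Rightarrow> bit) \<times> (nat \<Rightarrow> nat \<Rightarrow> nat \<Rightarrow> bit)) \<times> (nat \<Rightarrow> nat \<Rightarrow> bit)"
    assume z: "z \<in> left_inputs N i \<times> mats N" "z' \<in> left_inputs N i \<times> mats N"
      and zz: "(\<lambda>(l, M). (fst l, (snd l)(Suc i := M))) z = (\<lambda>(l, M). (fst l, (snd l)(Suc i := M))) z'"
    obtain x A M where zd1: "z = ((x, A), M)" by (cases z; cases "fst z") simp
    obtain x' A' M' where zd2: "z' = ((x', A'), M')" by (cases z'; cases "fst z'") simp
    note zd = zd1 zd2
    have eq: "(x, A(Suc i := M)) = (x', A'(Suc i := M'))" using zz by (simp add: zd)
    from z have "(x, A) \<in> left_inputs N i" "(x', A') \<in> left_inputs N i" by (auto simp: zd)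
    then have A: "A \<in> {1..i} \<rightarrow>\<^sub>E mats N" "A' \<in> {1..i} \<rightarrow>\<^sub>E mats N" by (auto simp: left_inputs_def)
    have e: "A(Suc i := M) = A'(Suc i := M')" using eq by simp
    have "A j = A' j" if "j \<in> {1..i}" for j using fun_cong[OF e, of j] that by auto
    then have "A = A'" using A by (intro PiE_ext) auto
    moreover have "M = M'" using fun_cong[OF e, of "Suc i"] by simp
    ultimately show "z = z'" using eq by (simp add: zd)
  qed
  have ins: "{1..Suc i} = insert (Suc i) {1..i}" by auto
  show "(\<lambda>(l, M). (fst l, (snd l)(Suc i := M))) ` (left_inputs N i \<times> mats N) = left_inputs N (Suc i)"
  proof (intro equalityI subsetI)
    fix z assume "z \<in> (\<lambda>(l, M). (fst l, (snd l)(Suc i := M))) ` (left_inputs N i \<times> mats N)"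
    then obtain l M where "l \<in> left_inputs N i" "M \<in> mats N" and z: "z = (fst l, (snd l)(Suc i := M))"
      by (elim imageE SigmaE) simp
    then show "z \<in> left_inputs N (Suc i)"
      unfolding left_inputs_def ins z mem_Times_iff fst_conv snd_conv
      by (intro conjI PiE_fun_upd) simp_all
  next
    fix z assume z: "z \<in> left_inputs N (Suc i)"
    then have "snd z \<in> (\<lambda>(M, A). A(Suc i := M)) ` (mats N \<times> ({1..i} \<rightarrow>\<^sub>E mats N))"
      unfolding left_inputs_def ins mem_Times_iff PiE_insert_eq by simp
    then obtain M A where MA: "M \<in> mats N" "A \<in> {1..i} \<rightarrow>\<^sub>E mats N" "snd z = A(Suc i := M)"
      by (elim imageE SigmaE) simp
    show "z \<in> (\<lambda>(l, M). (fst l, (snd l)(Suc i := M))) ` (left_inputs N i \<times> mats N)"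
      by (rule image_eqI[where x = "((fst z, A), M)"])
        (use z MA in \<open>simp_all add: left_inputs_def mem_Times_iff prod_eq_iff\<close>)
  qed
qed

section \<open>Guessing bounds in time and along the line\<close>

text \<open>Before the first round the transcript is empty, so a fixed list of at most
  \<open>L\<close> vectors is set against a uniform \<open>x\<close>.\<close>

lemma hard_to_guess_0:
  "hard_to_guess P N k s 0 0 L (real L / 2 ^ N)"
  unfolding hard_to_guess_def
proof (intro allI impI)
  fix \<rho> :: "nat \<Rightarrow> nat \<Rightarrow> nat \<Rightarrow> bit" and F :: "bool list \<Rightarrow> (nat \<Rightarrow> bit) set"
  assume F: "\<forall>h. F h \<subseteq> vecs N \<and> card (F h) \<le> L"
  have L0: "left_inputs N 0 = vecs N \<times> {\<lambda>_. undefined}" by (auto simp: left_inputs_def)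
  have "card {l \<in> left_inputs N 0. partial_product N 0 l \<in> F (link_hist P k s 0 0 (Suc 0) l \<rho>)}
      \<le> card (F [] \<times> {\<lambda>_ :: nat. undefined :: nat \<Rightarrow> nat \<Rightarrow> bit})"
  proof (rule card_mono)
    show "finite (F [] \<times> {\<lambda>_ :: nat. undefined :: nat \<Rightarrow> nat \<Rightarrow> bit})"
      using F finite_subset[of "F []" "vecs N"] by simp
    show "{l \<in> left_inputs N 0. partial_product N 0 l \<in> F (link_hist P k s 0 0 (Suc 0) l \<rho>)}
        \<subseteq> F [] \<times> {\<lambda>_. undefined}"
    proof
      fix l assume l: "l \<in> {l \<in> left_inputs N 0. partial_product N 0 l \<in> F (link_hist P k s 0 0 (Suc 0) l \<rho>)}"
      then have "fst l \<in> vecs N" "snd l = (\<lambda>_. undefined)" by (auto simp: L0)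
      moreover from this have "partial_product N 0 l = fst l"
        by (simp add: partial_product_def vecs_def PiE_restrict)
      ultimately show "l \<in> F [] \<times> {\<lambda>_. undefined}"
        using l by (simp add: link_hist_def mem_Times_iff)
    qed
  qed
  also have "\<dots> \<le> L" using F by (simp add: card_cartesian_product)
  finally show "real (card {l \<in> left_inputs N 0. partial_product N 0 l \<in> F (link_hist P k s 0 0 (Suc 0) l \<rho>)})
      \<le> real L / 2 ^ N * real (card (left_inputs N 0))"
    by (simp add: L0 card_cartesian_product card_vecs)
qed

text \<open>A list for the longer transcript gives one for the shorter: the union over the
  \<open>2 ^ d\<close> continuations.\<close>

lemma hard_to_guess_extend:
  assumes "hard_to_guess P N k s i t (2 ^ d * L) e" "i \<le> k"
  shows "hard_to_guess P N k s i (t + d) L e"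
  unfolding hard_to_guess_def
proof (intro allI impI)
  fix \<rho> :: "nat \<Rightarrow> nat \<Rightarrow> nat \<Rightarrow> bit" and F :: "bool list \<Rightarrow> (nat \<Rightarrow> bit) set"
  assume F: "\<forall>h. F h \<subseteq> vecs N \<and> card (F h) \<le> L"
  let ?W = "{w :: bool list. set w \<subseteq> UNIV \<and> length w = d}"
  define F' where "F' = (\<lambda>h. \<Union>w\<in>?W. F (h @ w))"
  have W: "finite ?W" "card ?W = 2 ^ d"
    using finite_lists_length_eq[of "UNIV :: bool set" d] card_lists_length_eq[of "UNIV :: bool set" d] by auto
  have "F' h \<subseteq> vecs N \<and> card (F' h) \<le> 2 ^ d * L" for h
  proof
    show "F' h \<subseteq> vecs N" using F by (auto simp: F'_def)
    have "card (F' h) \<le> (\<Sum>w\<in>?W. card (F (h @ w)))" unfolding F'_def by (rule card_UN_le[OF W(1)])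
    also have "\<dots> \<le> (\<Sum>w\<in>?W. L)" using F by (intro sum_mono) auto
    finally show "card (F' h) \<le> 2 ^ d * L" by (simp only: sum_constant W of_nat_id)
  qed
  then have "real (card {l \<in> left_inputs N i. partial_product N i l \<in> F' (link_hist P k s t i (Suc i) l \<rho>)})
      \<le> e * real (card (left_inputs N i))"
    using assms(1) unfolding hard_to_guess_def by blast
  moreover have "F (link_hist P k s (t + d) i (Suc i) l \<rho>) \<subseteq> F' (link_hist P k s t i (Suc i) l \<rho>)" for l
  proof -
    let ?h = "link_hist P k s (t + d) i (Suc i) l \<rho>"
    define w where "w = drop t ?h"
    have h: "?h = link_hist P k s t i (Suc i) l \<rho> @ w"
      using assms(2) append_take_drop_id[of t ?h] unfolding link_hist_def w_def
      by (simp add: hist_prefix)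
    have "w \<in> ?W" using assms(2) by (simp add: w_def link_hist_def length_hist)
    then show ?thesis
      unfolding F'_def h using UN_upper[of w ?W "\<lambda>w. F (link_hist P k s t i (Suc i) l \<rho> @ w)"] by simp
  qed
  then have "card {l \<in> left_inputs N i. partial_product N i l \<in> F (link_hist P k s (t + d) i (Suc i) l \<rho>)}
      \<le> card {l \<in> left_inputs N i. partial_product N i l \<in> F' (link_hist P k s t i (Suc i) l \<rho>)}"
    by (intro card_mono) auto
  ultimately show "real (card {l \<in> left_inputs N i. partial_product N i l \<in> F (link_hist P k s (t + d) i (Suc i) l \<rho>)})
      \<le> e * real (card (left_inputs N i))" by linarith
qed

text \<open>\<open>card_guess_step\<close> at player \<open>i + 1\<close>: the term
  \<open>2 / 2 ^ q\<close> is the fraction from \<open>card_concentrated_le\<close>, and the last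
  term pays for small fibres among the \<open>4 ^ t\<close> transcript pairs.\<close>

lemma hard_to_guess_Suc:
  assumes q: "8 * q \<le> N" and i: "Suc i \<le> k"
    and hard: "hard_to_guess P N k s i t (2 ^ (2 * q)) e"
  shows "hard_to_guess P N k s (Suc i) t (2 ^ (4 * q)) (e + 2 / 2 ^ q + 4 ^ t * 2 ^ q / 2 ^ (2 * q * q))"
  unfolding hard_to_guess_def
proof (intro allI impI)
  fix \<rho> :: "nat \<Rightarrow> nat \<Rightarrow> nat \<Rightarrow> bit" and F :: "bool list \<Rightarrow> (nat \<Rightarrow> bit) set"
  assume F: "\<forall>h. F h \<subseteq> vecs N \<and> card (F h) \<le> 2 ^ (4 * q)"
  \<comment> \<open>With \<open>M\<close> among the inputs to the right of link
    \<open>i + 1\<close>, both transcripts are functions of \<open>l\<close> and \<open>M\<close>,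
    and \<open>hard\<close> applies for each fixed \<open>M\<close>.\<close>
  define \<rho>' where "\<rho>' = (\<lambda>M. \<rho>(Suc i := M))"
  define a where "a = (\<lambda>l M. link_hist P k s t i (Suc i) l (\<rho>' M))"
  define b where "b = (\<lambda>l M. link_hist P k s t i (Suc (Suc i)) l (\<rho>' M))"
  let ?\<Omega> = "left_inputs N i" and ?f = "\<lambda>(l, M). (fst l, (snd l)(Suc i := M))"
  let ?H = "{h :: bool list. set h \<subseteq> UNIV \<and> length h = t}"
  let ?\<eta> = "2 ^ (N * N) * 2 ^ q / 2 ^ (2 * q * q) :: real"
  have H: "finite ?H" "card ?H = 2 ^ t"
    using finite_lists_length_eq[of "UNIV :: bool set" t] card_lists_length_eq[of "UNIV :: bool set" t] by auto
  have main: "real (card {(l, M) \<in> ?\<Omega> \<times> mats N. mv N M (partial_product N i l) \<in> F (b l M)})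
    \<le> (e + 2 / 2 ^ q) * (real (card ?\<Omega>) * real (card (mats N))) + real (card ?\<Omega>) * (real (card ?H) ^ 2 * ?\<eta>)"
  proof (rule card_guess_step[where a = a and V = "vecs N" and K = "2 ^ (2 * q)"])
    show "a l M \<in> ?H \<and> b l M \<in> ?H" for l M
      using i by (auto simp: a_def b_def link_hist_def length_hist)
    show "partial_product N i l \<in> vecs N" for l by (auto simp: partial_product_def vecs_def)
    show "a l M' = a l' M' \<and> b l M' = b l' M'" if "a l M = a l' M'" for l l' M M'
    proof -
      let ?inp = "\<lambda>l M. player_input k (fst l) (glue i (snd l) (\<rho>' M))"
      \<comment> \<open>Cut at link \<open>i + 1\<close>: the left inputs come from
        \<open>l\<close>, the right ones from the run of \<open>l'\<close> and
        \<open>M'\<close>.\<close>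
      have "\<forall>j\<ge>Suc i. hist P k (?inp l M') s t j = hist P k (?inp l' M') s t j"
        using hist_cut_paste[of "Suc i" k P "?inp l M" s t "?inp l' M'" "?inp l M'"] that i
        by (auto simp: a_def link_hist_def player_input_def glue_def)
      then show ?thesis by (simp add: a_def b_def link_hist_def)
    qed
    show "card {v \<in> vecs N. 2 / 2 ^ q * real (card \<A>) < real (card {M \<in> \<A>. mv N M v \<in> F h})} \<le> 2 ^ (2 * q)"
      if "\<A> \<subseteq> mats N" "?\<eta> < real (card \<A>)" for \<A> h
      using card_concentrated_le[OF q that(1), of "F h"] F that(2) by auto
    show "real (card {l \<in> ?\<Omega>. partial_product N i l \<in> F' (a l M)}) \<le> e * real (card ?\<Omega>)"
      if "\<And>h. F' h \<subseteq> vecs N" "\<And>h. card (F' h) \<le> 2 ^ (2 * q)" for M F'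
      using hard that unfolding hard_to_guess_def a_def by blast
  qed (use H in auto)
  have lh: "link_hist P k s t (Suc i) (Suc (Suc i)) (?f (l, M)) \<rho> = b l M" for l M
  proof -
    have "glue (Suc i) ((snd l)(Suc i := M)) \<rho> = glue i (snd l) (\<rho>' M)"
      by (auto simp: glue_def \<rho>'_def fun_eq_iff)
    then show ?thesis by (simp add: b_def link_hist_def)
  qed
  let ?X = "{l \<in> left_inputs N (Suc i). partial_product N (Suc i) l
    \<in> F (link_hist P k s t (Suc i) (Suc (Suc i)) l \<rho>)}"
  let ?Y = "{(l, M) \<in> ?\<Omega> \<times> mats N. mv N M (partial_product N i l) \<in> F (b l M)}"
  note bij = left_inputs_Suc_bij[of i N]
  have pp: "partial_product N (Suc i) (?f (l, M)) = mv N M (partial_product N i l)" for l M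
    using partial_product_Suc[of N i "fst l" "snd l" M] by simp
  have "?X \<subseteq> ?f ` ?Y"
  proof
    fix z assume z: "z \<in> ?X"
    then obtain l M where lM: "l \<in> ?\<Omega>" "M \<in> mats N" "z = ?f (l, M)"
      using bij_betw_imp_surj_on[OF bij] by blast
    with z have "(l, M) \<in> ?Y" using lh[of l M] pp[of l M] by simp
    with lM show "z \<in> ?f ` ?Y" by blast
  qed
  then have "card ?X \<le> card ?Y"
    by (rule surj_card_le[rotated]) (auto intro: finite_subset[of _ "?\<Omega> \<times> mats N"])
  then have "real (card ?X) \<le> real (card ?Y)" by simp
  also note main
  also have "(e + 2 / 2 ^ q) * (real (card ?\<Omega>) * real (card (mats N))) + real (card ?\<Omega>) * (real (card ?H) ^ 2 * ?\<eta>)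
    = (e + 2 / 2 ^ q + 4 ^ t * 2 ^ q / 2 ^ (2 * q * q)) * (real (card ?\<Omega>) * real (card (mats N)))"
  proof -
    have "real (card ?H) ^ 2 = 4 ^ t" unfolding H by (simp add: power2_eq_square flip: power_mult_distrib)
    moreover have "real (card (mats N)) = 2 ^ (N * N)" by (simp add: card_mats)
    ultimately show ?thesis by (simp add: algebra_simps)
  qed
  also have "real (card ?\<Omega>) * real (card (mats N)) = real (card (left_inputs N (Suc i)))"
    using bij_betw_same_card[OF bij] by (simp add: card_cartesian_product flip: of_nat_mult)
  finally show "real (card ?X) \<le> (e + 2 / 2 ^ q + 4 ^ t * 2 ^ q / 2 ^ (2 * q * q))
    * real (card (left_inputs N (Suc i)))" .
qed

lemma hard_to_guess_mono:
  assumes "hard_to_guess P N k s i t L e" "e \<le> e'" "L' \<le> L"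
  shows "hard_to_guess P N k s i t L' e'"
  unfolding hard_to_guess_def
proof (intro allI impI)
  fix \<rho> and F :: "bool list \<Rightarrow> (nat \<Rightarrow> bit) set"
  assume F: "\<forall>h. F h \<subseteq> vecs N \<and> card (F h) \<le> L'"
  then have "\<forall>h. F h \<subseteq> vecs N \<and> card (F h) \<le> L" using assms(3) order_trans by blast
  then have "real (card {l \<in> left_inputs N i. partial_product N i l \<in> F (link_hist P k s t i (Suc i) l \<rho>)})
      \<le> e * real (card (left_inputs N i))"
    using assms(1) unfolding hard_to_guess_def by blast
  also have "\<dots> \<le> e' * real (card (left_inputs N i))" using assms(2) by (rule mult_right_mono) simp
  finally show "real (card {l \<in> left_inputs N i. partial_product N i l \<in> F (link_hist P k s t i (Suc i) l \<rho>)})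
      \<le> e' * real (card (left_inputs N i))" .
qed

text \<open>Each player accounts for \<open>2 * q\<close> rounds: these shrink the list size from
  \<open>2 ^ (4 * q)\<close> to \<open>2 ^ (2 * q)\<close>, and the matrix restores it at an error
  of \<open>3 / 2 ^ q\<close>. The bound \<open>4 * t \<le> q * q\<close> keeps the small-fibre term
  at most \<open>1 / 2 ^ q\<close>.\<close>

lemma hard_to_guess_linear_time:
  assumes q: "8 * q \<le> N" "2 \<le> q" and "i \<le> k" "t \<le> 2 * q * i" "4 * t \<le> q * q"
  shows "hard_to_guess P N k s i t (2 ^ (4 * q)) (1 / 2 ^ (4 * q) + real i * (3 / 2 ^ q))"
  using assms(3-)
proof (induction i arbitrary: t)
  case 0
  have "(2::real) ^ (4 * q + 4 * q) \<le> 2 ^ N"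
    by (rule power_increasing) (use q in auto)
  then have "real (2 ^ (4 * q)) / 2 ^ N \<le> 1 / 2 ^ (4 * q)"
    by (simp only: power_add of_nat_power of_nat_numeral pos_divide_le_eq zero_less_power
      zero_less_numeral times_divide_eq_left mult_1 pos_le_divide_eq)
  from hard_to_guess_mono[OF hard_to_guess_0 this order_refl] 0(2)
  show ?case by (simp only: mult_0_right le_zero_eq of_nat_0 mult_zero_left add_0_right)
next
  case (Suc i)
  \<comment> \<open>Truncated subtraction: \<open>t0\<close> is 0 for \<open>t < 2 * q\<close>, and
    \<open>t - t0 \<le> 2 * q\<close> always.\<close>
  define t0 where "t0 = t - 2 * q"
  let ?e = "1 / 2 ^ (4 * q) + real i * (3 / 2 ^ q) :: real"
  have "t0 \<le> 2 * q * i" "4 * t0 \<le> q * q" using Suc.prems by (auto simp: t0_def)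
  then have "hard_to_guess P N k s i t0 (2 ^ (4 * q)) ?e"
    by (intro Suc.IH) (use Suc.prems in simp_all)
  moreover have "(2::nat) ^ (t - t0) * 2 ^ (2 * q) \<le> 2 ^ (4 * q)"
    unfolding power_add[symmetric] by (rule power_increasing) (auto simp: t0_def)
  ultimately have "hard_to_guess P N k s i t0 (2 ^ (t - t0) * 2 ^ (2 * q)) ?e"
    by (rule hard_to_guess_mono[OF _ order_refl])
  then have "hard_to_guess P N k s i (t0 + (t - t0)) (2 ^ (2 * q)) ?e"
    by (rule hard_to_guess_extend) (use Suc.prems in simp)
  then have "hard_to_guess P N k s i t (2 ^ (2 * q)) ?e" by (simp add: t0_def)
  from hard_to_guess_Suc[OF q(1) Suc.prems(1) this]
  have h: "hard_to_guess P N k s (Suc i) t (2 ^ (4 * q)) (?e + 2 / 2 ^ q + 4 ^ t * 2 ^ q / 2 ^ (2 * q * q))" .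
  have "4 ^ t * 2 ^ q / 2 ^ (2 * q * q) \<le> 1 / (2 ^ q :: real)"
  proof -
    have "2 * q \<le> q * q" using q(2) by (rule mult_le_mono1)
    then have "2 * t + 2 * q \<le> q * q + q * q" using Suc.prems(3) by linarith
    also have "\<dots> = 2 * q * q" by simp
    finally have "2 * t + 2 * q \<le> 2 * q * q" .
    then have "(2::real) ^ (2 * t + 2 * q) \<le> 2 ^ (2 * q * q)" by (intro power_increasing) auto
    moreover have "(2::real) ^ (2 * t + 2 * q) = 4 ^ t * 2 ^ q * 2 ^ q"
    proof -
      have "(2::real) ^ (2 * t) = 4 ^ t" unfolding power_mult by simp
      moreover have "(2::real) ^ (2 * q) = 2 ^ q * 2 ^ q" unfolding mult_2 power_add ..
      ultimately show ?thesis unfolding power_add by (simp only: mult.assoc)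
    qed
    ultimately show ?thesis
      by (simp only: pos_divide_le_eq zero_less_power zero_less_numeral times_divide_eq_left mult_1
        pos_le_divide_eq)
  qed
  then have "?e + 2 / 2 ^ q + 4 ^ t * 2 ^ q / 2 ^ (2 * q * q)
      \<le> 1 / 2 ^ (4 * q) + real (Suc i) * (3 / 2 ^ q)"
  proof -
    have "3 / 2 ^ q = 2 / 2 ^ q + 1 / (2 ^ q :: real)" by (simp flip: add_divide_distrib)
    moreover have "real (Suc i) * (3 / 2 ^ q) = real i * (3 / 2 ^ q) + 3 / 2 ^ q"
      by (simp only: of_nat_Suc distrib_right mult_1 add.commute)
    ultimately show ?thesis
      using \<open>4 ^ t * 2 ^ q / 2 ^ (2 * q * q) \<le> 1 / 2 ^ q\<close> by linarith
  qed
  then show ?case by (rule hard_to_guess_mono[OF h _ order_refl])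
qed

text \<open>A correct output is a one-element list containing \<open>y\<^sub>k\<close>, computed
  from the transcript of the last link.\<close>

lemma card_success_le:
  assumes q: "8 * q \<le> N" "2 \<le> q" and T: "T \<le> 2 * q * k" "4 * T \<le> q * q"
  shows "real (card {l \<in> left_inputs N k. success P N k T (fst l) (snd l) s})
    \<le> (1 / 2 ^ (4 * q) + real k * (3 / 2 ^ q)) * real (card (left_inputs N k))"
proof -
  define F where "F = (\<lambda>h. {restrict (out P (s (k + 1)) h) {0..<N}})"
  have F: "\<forall>h. F h \<subseteq> vecs N \<and> card (F h) \<le> 2 ^ (4 * q)" by (auto simp: F_def vecs_def)
  \<comment> \<open>All matrices lie to the left of link \<open>k + 1\<close>, so
    \<open>undefined\<close> serves as a placeholder for the right inputs.\<close>
  have inp: "player_input k x (glue k A undefined) = player_input k x A" for x A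
    by (auto simp: player_input_def glue_def fun_eq_iff)
  have "{l \<in> left_inputs N k. success P N k T (fst l) (snd l) s}
    \<subseteq> {l \<in> left_inputs N k. partial_product N k l \<in> F (link_hist P k s T k (Suc k) l undefined)}"
  proof (intro Collect_mono impI conjI; elim conjE)
    fix l assume "success P N k T (fst l) (snd l) s"
    then have "restrict (chain N (snd l) k (fst l)) {0..<N}
        = restrict (out P (s (k + 1)) (hist P k (player_input k (fst l) (snd l)) s T (k + 1))) {0..<N}"
      unfolding success_def by (intro restrict_ext) simp
    then show "partial_product N k l \<in> F (link_hist P k s T k (Suc k) l undefined)"
      by (simp only: partial_product_def F_def link_hist_def inp Suc_eq_plus1 singleton_iff)
  qed
  then have "card {l \<in> left_inputs N k. success P N k T (fst l) (snd l) s}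
    \<le> card {l \<in> left_inputs N k. partial_product N k l \<in> F (link_hist P k s T k (Suc k) l undefined)}"
    by (rule card_mono[rotated]) simp
  moreover have "real (card {l \<in> left_inputs N k. partial_product N k l \<in> F (link_hist P k s T k (Suc k) l undefined)})
    \<le> (1 / 2 ^ (4 * q) + real k * (3 / 2 ^ q)) * real (card (left_inputs N k))"
    using hard_to_guess_linear_time[OF q order_refl T, of P s] F unfolding hard_to_guess_def by blast
  ultimately show ?thesis by linarith
qed

section \<open>From counts to probabilities\<close>

text \<open>Averaging over \<open>y\<close>. With the seeds as \<open>y\<close> this reduces
  randomized protocols to deterministic ones.\<close>

lemma prob_pair_pmf_le:
  assumes "\<And>y. measure_pmf.prob p {x. (x, y) \<in> E} \<le> e"
  shows "measure_pmf.prob (pair_pmf p q) E \<le> e"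
proof -
  have e: "0 \<le> e" using assms[of undefined] measure_nonneg order_trans by blast
  have "pair_pmf p q = bind_pmf q (\<lambda>y. map_pmf (\<lambda>x. (x, y)) p)"
    unfolding pair_pmf_def map_pmf_def by (rule bind_commute_pmf)
  then have "emeasure (pair_pmf p q) E = (\<integral>\<^sup>+ y. emeasure p ((\<lambda>x. (x, y)) -` E) \<partial>q)"
    by (simp add: emeasure_bind_pmf)
  also have "\<dots> \<le> (\<integral>\<^sup>+ y. ennreal e \<partial>q)"
    using assms by (intro nn_integral_mono) (simp add: measure_pmf.emeasure_eq_measure vimage_def ennreal_leI)
  also have "\<dots> = ennreal e" by (simp add: measure_pmf.emeasure_space_1[simplified])
  finally show ?thesis using e by (simp add: measure_pmf.emeasure_eq_measure)
qed

lemma pair_pmf_of_set: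
  assumes "finite A" "A \<noteq> {}" "finite B" "B \<noteq> {}"
  shows "pair_pmf (pmf_of_set A) (pmf_of_set B) = pmf_of_set (A \<times> B)"
proof (rule pmf_eqI)
  fix z :: "'a \<times> 'b"
  show "pmf (pair_pmf (pmf_of_set A) (pmf_of_set B)) z = pmf (pmf_of_set (A \<times> B)) z"
    using assms by (cases z) (simp add: pmf_pair card_cartesian_product indicator_def)
qed

lemma success_prob_le:
  assumes "8 * q \<le> N" "2 \<le> q" "T \<le> 2 * q * k" "4 * T \<le> q * q"
  shows "success_prob P N k R T \<le> 1 / 2 ^ (4 * q) + real k * (3 / 2 ^ q)"
  unfolding success_prob_def
proof (rule prob_pair_pmf_le)
  fix s
  have ne: "vecs N \<noteq> {}" "({1..k} \<rightarrow>\<^sub>E mats N) \<noteq> {}"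
    by (simp_all add: vecs_def mats_def PiE_eq_empty_iff)
  have fin: "finite ({1..k} \<rightarrow>\<^sub>E mats N)" by (simp add: finite_PiE)
  have "pair_pmf (pmf_of_set (vecs N)) (pmf_of_set ({1..k} \<rightarrow>\<^sub>E mats N)) = pmf_of_set (left_inputs N k)"
    unfolding left_inputs_def  using ne fin by (intro pair_pmf_of_set) simp_all
  moreover have ne': "left_inputs N k \<noteq> {}" using ne by (simp add: left_inputs_def)
  moreover have "left_inputs N k \<inter> {l. (l, s) \<in> {((x, A), s). success P N k T x A s}}
    = {l \<in> left_inputs N k. success P N k T (fst l) (snd l) s}" by auto
  moreover have "0 < card (left_inputs N k)" using ne' by (simp add: card_gt_0_iff)
  ultimately show "measure_pmf.prob (pair_pmf (pmf_of_set (vecs N)) (pmf_of_set ({1..k} \<rightarrow>\<^sub>E mats N)))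
      {l. (l, s) \<in> {((x, A), s). success P N k T x A s}} \<le> 1 / 2 ^ (4 * q) + real k * (3 / 2 ^ q)"
    using card_success_le[OF assms, of P s] by (simp add: measure_pmf_of_set divide_le_eq)
qed

section \<open>Choice of the constants\<close>

lemma power_two_ge_linear: "12 \<le> q \<Longrightarrow> 200 * q \<le> (2::nat) ^ q"
  by (induction q rule: nat_induct_at_least) auto

theorem theorem6p4:
  shows "\<exists>c::real. c > 0 \<and> (\<exists>N0::nat. \<forall>N\<ge>N0. \<forall>k::nat. 1 \<le> k \<and> k \<le> N \<longrightarrow>
           (\<forall>(P::protocol) (R::nat \<Rightarrow> nat pmf) (T::nat).
              success_prob P N k R T \<ge> 1/2 \<longrightarrow> real T \<ge> c * real k * real N))"
proof (intro exI conjI allI impI)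
  \<comment> \<open>For \<open>q = N div 8\<close> both \<open>k\<close> and \<open>N\<close> are at
    most \<open>16 * q\<close>, so \<open>1024 * T < k * N\<close> gives
    \<open>1024 * T < 256 * q * q\<close>, which is what \<open>4 * T \<le> q * q\<close>
    needs.\<close>
  show "(1 / 1024 :: real) > 0" by simp
  fix N k T :: nat and P :: protocol and R :: "nat \<Rightarrow> nat pmf"
  \<comment> \<open>The threshold is 8 * 12, so that \<open>q \<ge> 12\<close>, where
    \<open>200 * q \<le> 2 ^ q\<close> starts.\<close>
  assume N: "96 \<le> N" and k: "1 \<le> k \<and> k \<le> N" and succ: "1 / 2 \<le> success_prob P N k R T"
  show "1 / 1024 * real k * real N \<le> real T"
  proof (rule ccontr)
    assume "\<not> ?thesis"
    then have "real (1024 * T) < real (k * N)" by simp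
    then have T: "1024 * T < k * N" by (simp only: of_nat_less_iff)
    define q where "q = N div 8"
    have q: "8 * q \<le> N" "12 \<le> q" "N \<le> 16 * q" using N by (auto simp: q_def)
    have "k * N \<le> k * (16 * q)" using q by (intro mult_le_mono) auto
    also have "\<dots> \<le> 1024 * (2 * q * k)" by (simp add: algebra_simps)
    finally have T1: "T \<le> 2 * q * k" using T by linarith
    have "k * N \<le> (16 * q) * (16 * q)" using q k by (intro mult_le_mono) auto
    then have T2: "4 * T \<le> q * q" using T by simp
    have "real (200 * q) \<le> real (2 ^ q)"
      using power_two_ge_linear[OF q(2)] by (simp only: of_nat_le_iff)
    then have two: "200 * real q \<le> 2 ^ q" by simp
    \<comment> \<open>The errors of all players sum to at most 48/200; with at most 1/4 from the
      start the total stays below 1/2.\<close>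
    have "real k * (3 / 2 ^ q) \<le> 48 * real q / 2 ^ q"
      using k q(3) by (simp add: field_simps)
    also have "\<dots> \<le> 48 / 200" using two by (simp add: field_simps)
    finally have 1: "real k * (3 / 2 ^ q) \<le> 48 / 200" .
    have "(2::real) ^ 2 \<le> 2 ^ (4 * q)" using q by (intro power_increasing) auto
    then have "1 / 2 ^ (4 * q) \<le> (1 / 4 :: real)" by (simp add: field_simps)
    moreover have "success_prob P N k R T \<le> 1 / 2 ^ (4 * q) + real k * (3 / 2 ^ q)"
      by (rule success_prob_le[OF q(1) _ T1 T2]) (use q in simp)
    ultimately show False using succ 1 by linarith
  qed
qed

end
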